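(* Let $(V,E)$ be a countably infinite graph with vertex set $V$, edge set $E$ and uniformly bounded vertex degrees. (i) Let $\tau_v$, $v\in V$, be independent and uniformly distributed on $[0,1]$. For finite $U\subseteq V$ let $(X_t^{U}(v))$ denote the blocking RSA process on the subgraph induced by $U$, driven by $(\tau_v)_{v\in U}$. Then, except on an event of probability zero, for all $v\in V$, all $t\in[0,1]$ and every sequence $(V_n)_{n\ge 1}$ of finite subsets of $V$ with $\liminf (V_n)=V$, the limit $$X_t^V(v):=\lim_{n\to\infty}X_t^{V_n}(v)$$ exists and does not depend on the choice of $(V_n)_{n\ge1}$. (ii) Let $\tau_e$, $e\in E$, be independent and uniformly distributed on $[0,1]$. For finite $U\subseteq V$ let $(X_t^{U}(v))$ denote either the dimer RSA process or the annihilation process on the subgraph induced by $U$, driven by the $\tau_e$ (and, for the annihilation process, by the attack directions) of the edges $e\in E$ with both endpoints in $U$. Then, for either process, except on an event of probability zero, for all $v\in V$, all $t\in[0,1]$ and every sequence $(V_n)_{n\ge 1}$ of finite subsets of $V$ with $\liminf (V_n)=V$, the limit $X_t^V(v):=\lim_{n\to\infty}X_t^{V_n}(v)$ exists and does not depend on the choice of $(V_n)_{n\ge 1}$.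
   Context: Graphs have no loops or multiple edges. For sets, $\liminf(V_n):=\bigcup_{n\ge1}\bigcap_{m\ge n}V_m$; thus if $\liminf (V_n)=V$, then each $v\in V$ lies in $V_n$ for all large $n$, so $X_t^{V_n}(v)$ is defined for all large $n$. Processes on a finite graph with vertex set $U$ and edge set $E_U$; states are $1$ (occupied) and $0$ (vacant), and $X_t^U(v)$ is the state of $v$ at time $t$. Blocking RSA: the $\tau_v$, $v\in U$, are i.i.d. uniform on $(0,1)$. All sites are initially vacant; at time $\tau_v$ site $v$ becomes occupied if and only if none of its neighbours is already occupied (otherwise nothing changes). Occupied sites stay occupied forever. Dimer RSA: the $\tau_e$, $e\in E_U$, are i.i.d. uniform on $(0,1)$. All sites are initially vacant; at time $\tau_e$, $e=\{u,v\}$, if $u$ and $v$ are both vacant then both become occupied (otherwise nothing changes). Occupied sites stay occupied forever. Annihilation process: the $\tau_e$, $e\in E_U$, are i.i.d. uniform on $(0,1)$, and each edge independently has a random attack direction, each of the two directions having probability $1/2$ (directions independent of the $\tau_e$). All sites are initially occupied; at time $\tau_e$, $e=\{u,v\}$, if $u$ and $v$ are both occupied immediately before, then the attacked endpoint (determined by the direction) becomes vacant; otherwise nothing changes. Vacant sites stay vacant forever. *)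

theory Defs
  imports "HOL-Probability.Probability"
begin

definition simple_graph :: "'v set \<Rightarrow> 'v set set \<Rightarrow> bool" where
  "simple_graph V E \<longleftrightarrow> (\<forall>e\<in>E. e \<subseteq> V \<and> card e = 2)"

(* Finiteness is stated separately because card is 0 on infinite sets. *)
definition bounded_degree :: "'v set \<Rightarrow> 'v set set \<Rightarrow> bool" where
  "bounded_degree V E \<longleftrightarrow> (\<exists>D. \<forall>v\<in>V. finite {e \<in> E. v \<in> e} \<and> card {e \<in> E. v \<in> e} \<le> D)"

definition induced_edges :: "'v set set \<Rightarrow> 'v set \<Rightarrow> 'v set set" where
  "induced_edges E U = {e \<in> E. e \<subseteq> U}"

(* For a finite set A on which the clocks are pairwise distinct, this is the unique list of the
   elements of A in increasing order of their clocks. Independent uniform clocks are almost surely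
   distinct; if there are ties, they are broken in an arbitrary way. *)
definition chronological :: "('i \<Rightarrow> real) \<Rightarrow> 'i set \<Rightarrow> 'i list" where
  "chronological \<tau> A = (SOME xs. distinct xs \<and> set xs = A \<and> sorted (map \<tau> xs))"

lemma chronological:
  assumes "finite A"
  shows "distinct (chronological \<tau> A)" "set (chronological \<tau> A) = A"
    "sorted (map \<tau> (chronological \<tau> A))"
proof -
  obtain xs where "distinct xs" "set xs = A"
    using finite_distinct_list[OF assms] by blast
  then have "distinct (sort_key \<tau> xs) \<and> set (sort_key \<tau> xs) = A \<and> sorted (map \<tau> (sort_key \<tau> xs))"
    by simp
  then have "distinct (chronological \<tau> A) \<and> set (chronological \<tau> A) = A
      \<and> sorted (map \<tau> (chronological \<tau> A))"
    unfolding chronological_def by (rule someI)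
  then show "distinct (chronological \<tau> A)" "set (chronological \<tau> A) = A"
    "sorted (map \<tau> (chronological \<tau> A))" by auto
qed

(* Starting from s, the update belonging to i is performed at time tau i; the result is the state
   at time t, the update at time t itself included. *)
definition evolve ::
    "('i \<Rightarrow> 's \<Rightarrow> 's) \<Rightarrow> ('i \<Rightarrow> real) \<Rightarrow> 'i set \<Rightarrow> 's \<Rightarrow> real \<Rightarrow> 's" where
  "evolve step \<tau> A s t = fold step (filter (\<lambda>i. \<tau> i \<le> t) (chronological \<tau> A)) s"

(* States are 1 (occupied) and 0 (vacant). In the three processes below, F is the edge set of a
   finite graph, and the values at sites that are not vertices of that graph have no meaning. *)

definition blocking_step :: "'v set set \<Rightarrow> 'v \<Rightarrow> ('v \<Rightarrow> nat) \<Rightarrow> ('v \<Rightarrow> nat)" where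
  "blocking_step F v x = (if \<forall>u. {u, v} \<in> F \<longrightarrow> x u = 0 then x(v := 1) else x)"

definition blocking_rsa ::
    "'v set \<Rightarrow> 'v set set \<Rightarrow> ('v \<Rightarrow> real) \<Rightarrow> real \<Rightarrow> 'v \<Rightarrow> nat" where
  "blocking_rsa U F \<tau> t = evolve (blocking_step F) \<tau> U (\<lambda>_. 0) t"

definition dimer_step :: "'v set \<Rightarrow> ('v \<Rightarrow> nat) \<Rightarrow> ('v \<Rightarrow> nat)" where
  "dimer_step e x = (if \<forall>v\<in>e. x v = 0 then (\<lambda>v. if v \<in> e then 1 else x v) else x)"

definition dimer_rsa :: "'v set set \<Rightarrow> ('v set \<Rightarrow> real) \<Rightarrow> real \<Rightarrow> 'v \<Rightarrow> nat" where
  "dimer_rsa F \<tau> t = evolve dimer_step \<tau> F (\<lambda>_. 0) t"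

(* The attack direction of an edge e is given by its attacked endpoint a e. *)
definition annihilation_step ::
    "('v set \<Rightarrow> 'v) \<Rightarrow> 'v set \<Rightarrow> ('v \<Rightarrow> nat) \<Rightarrow> ('v \<Rightarrow> nat)" where
  "annihilation_step a e x = (if \<forall>v\<in>e. x v = 1 then x(a e := 0) else x)"

definition annihilation ::
    "'v set set \<Rightarrow> ('v set \<Rightarrow> real) \<Rightarrow> ('v set \<Rightarrow> 'v) \<Rightarrow> real \<Rightarrow> 'v \<Rightarrow> nat" where
  "annihilation F \<tau> a t = evolve (annihilation_step a) \<tau> F (\<lambda>_. 1) t"

definition iid_uniform_clocks :: "'w measure \<Rightarrow> 'i set \<Rightarrow> ('i \<Rightarrow> 'w \<Rightarrow> real) \<Rightarrow> bool" where
  "iid_uniform_clocks M I \<tau> \<longleftrightarrow>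
     prob_space.indep_vars M (\<lambda>_. borel) \<tau> I \<and>
     (\<forall>i\<in>I. distr M borel (\<tau> i) = uniform_measure lborel {0..1})"

(* Independent fair choices of an endpoint of each edge, such that the family of all choices is
   independent of the family of all clocks. *)
definition fair_attack_directions ::
    "'w measure \<Rightarrow> 'v set set \<Rightarrow> ('v set \<Rightarrow> 'w \<Rightarrow> real) \<Rightarrow> ('v set \<Rightarrow> 'w \<Rightarrow> 'v) \<Rightarrow> bool" where
  "fair_attack_directions M E \<tau> \<alpha> \<longleftrightarrow>
     prob_space.indep_vars M (\<lambda>e. count_space e) \<alpha> E \<and>
     (\<forall>e\<in>E. \<forall>v\<in>e. measure M {\<omega> \<in> space M. \<alpha> e \<omega> = v} = 1 / 2) \<and>
     prob_space.indep_set M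
       (sigma_sets (space M) (\<Union>e\<in>E. {\<tau> e -` B \<inter> space M | B. B \<in> sets borel}))
       (sigma_sets (space M) (\<Union>e\<in>E. {\<alpha> e -` B \<inter> space M | B. B \<in> sets (count_space e)}))"

definition finite_approximation :: "'v set \<Rightarrow> (nat \<Rightarrow> 'v set) \<Rightarrow> bool" where
  "finite_approximation V W \<longleftrightarrow>
     (\<forall>n\<ge>1. finite (W n) \<and> W n \<subseteq> V) \<and> (\<Union>n\<in>{1..}. \<Inter>m\<in>{n..}. W m) = V"

(* X U t v is the state of v at time t of the process on the finite vertex set U. The limit L is
   chosen before the sequence W, so it does not depend on W. *)
definition has_infinite_volume_limit ::
    "'v set \<Rightarrow> ('v set \<Rightarrow> real \<Rightarrow> 'v \<Rightarrow> nat) \<Rightarrow> bool" where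
  "has_infinite_volume_limit V X \<longleftrightarrow>
     (\<forall>v\<in>V. \<forall>t\<in>{0..1}. \<exists>L. \<forall>W. finite_approximation V W \<longrightarrow> (\<lambda>n. X (W n) t v) \<longlonglongrightarrow> L)"

end

theory Submission
  imports Defs "HOL-Real_Asymp.Real_Asymp"
begin

text \<open>
  This is Harris's graphical argument. Each of the three processes performs, in the order of the
  clocks, updates that belong to \<^emph>\<open>items\<close> (the sites for blocking RSA, the edges for the
  other two), and the update of an item reads and writes only a small set of sites, its
  \<^emph>\<open>scope\<close>. Boundedness of the degrees means that an item shares sites with a bounded number
  of others. The state of a site can only be influenced by items that are reached
  from it by a chain of items with overlapping scopes and decreasing clocks: its causal past.
  Once a finite vertex set contains the causal past, enlarging it further does not change the state
  (\<open>evolve_determined_by_causal_past\<close>). So the limit exists, and equals the result of the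
  process run on the causal past alone, as soon as that past is finite; and since branching is
  finite, the past is finite if there is no infinite chain of decreasing clocks.

  The absence of such chains almost surely is the only probabilistic point (\<open>AE_wf_precedes\<close>).
  Cut the unit interval into \<open>D + 1\<close> cells of equal length, where \<open>D\<close> bounds the number of
  overlapping items. An infinite decreasing chain would eventually stay in a single cell, and would
  consist of distinct items. But a given path of \<open>k + 1\<close> distinct items has all its clocks in a
  given cell with probability at most \<open>1 / (D + 1) ^ (k + 1)\<close>, while at most \<open>D ^ k\<close> such paths
  start at a given item, so the probability that there is one tends to 0; this is a subcritical
  percolation estimate. The product formula for cells also shows that almost surely no two clocks
  coincide, so that the chronological order of the items is determined and is
  inherited by subsets.
\<close>

section \<open>Local updates and causal pasts\<close>

definition local_update :: "'v set \<Rightarrow> (('v \<Rightarrow> 's) \<Rightarrow> ('v \<Rightarrow> 's)) \<Rightarrow> bool" where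
  "local_update S f \<longleftrightarrow>
     (\<forall>x. \<forall>v. v \<notin> S \<longrightarrow> f x v = x v) \<and>
     (\<forall>x y. (\<forall>v\<in>S. x v = y v) \<longrightarrow> (\<forall>v\<in>S. f x v = f y v))"

definition overlaps :: "'i set \<Rightarrow> ('i \<Rightarrow> 'v set) \<Rightarrow> 'i \<Rightarrow> 'i set" where
  "overlaps I scope i = {j \<in> I. scope i \<inter> scope j \<noteq> {}}"

definition precedes :: "'i set \<Rightarrow> ('i \<Rightarrow> 'i set) \<Rightarrow> ('i \<Rightarrow> real) \<Rightarrow> ('i \<times> 'i) set" where
  "precedes I nb \<tau> = {(j, i). i \<in> I \<and> j \<in> nb i \<and> \<tau> j < \<tau> i}"

text \<open>
  Skipping the items outside \<open>C\<close> preserves agreement on the sites that still matter, namely \<open>v\<close>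
  and the scopes of the items of \<open>C\<close> yet to come. The invariant has to shrink in this way: on the
  scope of an item of \<open>C\<close> that has already been treated, a skipped item may well act later.
\<close>
lemma fold_skips_irrelevant_updates:
  assumes "\<And>i. i \<in> set xs \<Longrightarrow> local_update (scope i) (step i)"
    and "sorted_wrt (\<lambda>j i. j \<notin> C \<longrightarrow> i \<in> C \<longrightarrow> scope j \<inter> scope i = {}) xs"
    and "\<And>j. j \<in> set xs \<Longrightarrow> j \<notin> C \<Longrightarrow> v \<notin> scope j"
    and "\<And>u. u \<in> insert v (\<Union>i\<in>set xs \<inter> C. scope i) \<Longrightarrow> x u = y u"
  shows "fold step xs x v = fold step (filter (\<lambda>i. i \<in> C) xs) y v"
  using assms
proof (induction xs arbitrary: x y)
  case Nil
  then show ?case by simp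
next
  case (Cons i xs)
  have loc: "local_update (scope i) (step i)" using Cons.prems(1) by simp
  have IH: "fold step xs x' v = fold step (filter (\<lambda>i. i \<in> C) xs) y' v"
    if "\<And>u. u \<in> insert v (\<Union>i\<in>set xs \<inter> C. scope i) \<Longrightarrow> x' u = y' u" for x' y'
    by (rule Cons.IH) (use Cons.prems that in auto)
  show ?case
  proof (cases "i \<in> C")
    case True
    have "step i x u = step i y u" if "u \<in> insert v (\<Union>i\<in>set xs \<inter> C. scope i)" for u
    proof (cases "u \<in> scope i")
      case True
      moreover have "\<forall>w\<in>scope i. x w = y w" using Cons.prems(4) \<open>i \<in> C\<close> by auto
      ultimately show ?thesis using loc unfolding local_update_def by blast
    next
      case False
      moreover have "x u = y u" using Cons.prems(4) that by auto
      ultimately show ?thesis using loc unfolding local_update_def by metis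
    qed
    then show ?thesis using IH True by simp
  next
    case False
    have "step i x u = y u" if u: "u \<in> insert v (\<Union>i\<in>set xs \<inter> C. scope i)" for u
    proof -
      have "u \<notin> scope i" using u False Cons.prems(2,3) by auto
      moreover have "x u = y u" using Cons.prems(4) u by auto
      ultimately show ?thesis using loc unfolding local_update_def by metis
    qed
    then show ?thesis using IH False by simp
  qed
qed

lemma filter_chronological:
  assumes "finite A" and "C \<subseteq> A" and "inj_on \<tau> C"
  shows "filter (\<lambda>i. i \<in> C) (chronological \<tau> A) = chronological \<tau> C"
proof -
  have C: "finite C" using assms finite_subset by blast
  note A = chronological[OF assms(1), of \<tau>] and C = chronological[OF C, of \<tau>]
  let ?l = "filter (\<lambda>i. i \<in> C) (chronological \<tau> A)"
  have s: "set ?l = C" using A(2) assms(2) by auto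
  show ?thesis
  proof (rule map_sorted_distinct_set_unique)
    show "inj_on \<tau> (set ?l \<union> set (chronological \<tau> C))" using s C assms(3) by simp
    show "sorted (map \<tau> ?l)" using A(3) by (rule sorted_filter)
    show "distinct (map \<tau> ?l)" using A(1) s assms(3) by (simp add: distinct_map)
    show "distinct (map \<tau> (chronological \<tau> C))" using C assms(3) by (simp add: distinct_map)
  qed (use s C in auto)
qed

text \<open>
  An item outside \<open>C\<close> may overlap an item of \<open>C\<close> only if it comes later, and it does not touch
  \<open>v\<close>; hence its effect is never seen.
\<close>
lemma evolve_determined_by_causal_past:
  assumes "finite A" and "C \<subseteq> A" and inj: "inj_on \<tau> A"
    and loc: "\<And>i. i \<in> A \<Longrightarrow> local_update (scope i) (step i)"
    and visible: "\<And>i. i \<in> A \<Longrightarrow> v \<in> scope i \<Longrightarrow> i \<in> C"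
    and closed: "\<And>i j. i \<in> C \<Longrightarrow> j \<in> A \<Longrightarrow> scope i \<inter> scope j \<noteq> {} \<Longrightarrow> \<tau> j < \<tau> i \<Longrightarrow> j \<in> C"
  shows "evolve step \<tau> A s t v = evolve step \<tau> C s t v"
proof -
  note A = chronological[OF assms(1), of \<tau>]
  let ?xs = "filter (\<lambda>i. \<tau> i \<le> t) (chronological \<tau> A)"
  have "sorted_wrt (\<lambda>j i. \<tau> j < \<tau> i) (chronological \<tau> A)"
  proof -
    have "sorted_wrt (<) (map \<tau> (chronological \<tau> A))"
      using A inj by (simp add: strict_sorted_iff distinct_map)
    then show ?thesis by (simp add: sorted_wrt_map)
  qed
  then have "sorted_wrt (\<lambda>j i. \<tau> j < \<tau> i) ?xs" by (rule sorted_wrt_filter)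
  then have so: "sorted_wrt (\<lambda>j i. j \<notin> C \<longrightarrow> i \<in> C \<longrightarrow> scope j \<inter> scope i = {}) ?xs"
    by (rule sorted_wrt_mono_rel[rotated]) (use closed A(2) in auto)
  have "fold step ?xs s v = fold step (filter (\<lambda>i. i \<in> C) ?xs) s v"
    by (rule fold_skips_irrelevant_updates[where scope = scope])
      (use so loc visible A(2) in auto)
  also have "filter (\<lambda>i. i \<in> C) ?xs = filter (\<lambda>i. \<tau> i \<le> t) (filter (\<lambda>i. i \<in> C) (chronological \<tau> A))"
    by (simp add: conj_commute)
  also have "\<dots> = filter (\<lambda>i. \<tau> i \<le> t) (chronological \<tau> C)"
    using filter_chronological[OF assms(1,2) inj_on_subset[OF inj assms(2)]] by simp
  finally show ?thesis unfolding evolve_def .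
qed

text \<open>Koenig's lemma, obtained by well-founded induction along the decreasing chains.\<close>
lemma finite_causal_past:
  assumes wf: "wf (precedes I nb \<tau>)" and "\<And>i. i \<in> I \<Longrightarrow> finite (nb i)"
  shows "finite {j. (j, i) \<in> (precedes I nb \<tau>)\<^sup>*}"
  using wf
proof (induction i rule: wf_induct_rule)
  case (less i)
  let ?R = "precedes I nb \<tau>"
  have "{j. (j, i) \<in> ?R\<^sup>*} \<subseteq> insert i (\<Union>k\<in>{k. (k, i) \<in> ?R}. {j. (j, k) \<in> ?R\<^sup>*})"
    by (auto elim: rtranclE)
  moreover have "finite {k. (k, i) \<in> ?R}"
  proof (cases "i \<in> I")
    case True
    then show ?thesis
      by (intro finite_subset[OF _ assms(2)[OF True]]) (auto simp: precedes_def)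
  qed (simp add: precedes_def)
  ultimately show ?case using less.IH by (auto intro: finite_subset)
qed

text \<open>
  The common value \<open>L\<close> is the result of the process on the causal past of \<open>v\<close>, so it is fixed
  before the exhausting sequence.
\<close>
lemma evolve_eventually_stable:
  assumes inj: "inj_on \<tau> I" and wf: "wf (precedes I (overlaps I scope) \<tau>)"
    and fin: "\<And>i. i \<in> I \<Longrightarrow> finite (overlaps I scope i)"
    and finv: "finite {i \<in> I. v \<in> scope i}"
    and loc: "\<And>i. i \<in> I \<Longrightarrow> local_update (scope i) (step i)"
  obtains L where "\<And>A. \<forall>i\<in>I. eventually (\<lambda>n. i \<in> A n) sequentially \<Longrightarrow>
      eventually (\<lambda>n. finite (A n) \<and> A n \<subseteq> I) sequentially \<Longrightarrow>
      eventually (\<lambda>n. evolve step \<tau> (A n) s t v = L) sequentially"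
proof
  let ?R = "precedes I (overlaps I scope) \<tau>"
  define C where "C = (\<Union>i\<in>{i \<in> I. v \<in> scope i}. {j. (j, i) \<in> ?R\<^sup>*})"
  have "finite C" unfolding C_def using finv finite_causal_past[OF wf fin] by blast
  have CI: "C \<subseteq> I"
    unfolding C_def by (auto elim: converse_rtranclE simp: precedes_def overlaps_def)
  fix A :: "nat \<Rightarrow> 'a set"
  assume ev: "\<forall>i\<in>I. eventually (\<lambda>n. i \<in> A n) sequentially"
    and evf: "eventually (\<lambda>n. finite (A n) \<and> A n \<subseteq> I) sequentially"
  have "eventually (\<lambda>n. \<forall>i\<in>C. i \<in> A n) sequentially"
    using ev CI \<open>finite C\<close> by (intro eventually_ball_finite) auto
  then show "eventually (\<lambda>n. evolve step \<tau> (A n) s t v = evolve step \<tau> C s t v) sequentially"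
    using evf
  proof eventually_elim
    case (elim n)
    show ?case
    proof (rule evolve_determined_by_causal_past[where scope = scope])
      show "inj_on \<tau> (A n)" using inj elim inj_on_subset by blast
      show "i \<in> C" if "i \<in> A n" "v \<in> scope i" for i
        using that elim unfolding C_def by auto
      show "j \<in> C" if ij: "i \<in> C" "j \<in> A n" "scope i \<inter> scope j \<noteq> {}" "\<tau> j < \<tau> i" for i j
      proof -
        have "(j, i) \<in> ?R" using ij elim CI by (auto simp: precedes_def overlaps_def)
        then show ?thesis using ij(1) unfolding C_def by (auto intro: converse_rtrancl_into_rtrancl)
      qed
    qed (use elim loc in auto)
  qed
qed

section \<open>Random clocks\<close>

text \<open>
  Half-open, so that the cell of a clock is given by a floor function, which is monotone.
  The value 1 falls into the additional cell with index \<open>n\<close>.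
\<close>
definition cell :: "nat \<Rightarrow> nat \<Rightarrow> real set" where
  "cell n m = {real m / real n ..< (real m + 1) / real n}"

lemma cell_index:
  assumes "0 < n" and "x \<in> {0..1}"
  shows "x \<in> cell n (nat \<lfloor>real n * x\<rfloor>)" and "nat \<lfloor>real n * x\<rfloor> \<le> n"
proof -
  have 0: "0 \<le> real n * x" and 1: "real n * x \<le> real n"
    using assms by (auto simp: mult_left_le)
  have *: "real (nat \<lfloor>real n * x\<rfloor>) = of_int \<lfloor>real n * x\<rfloor>" using 0 by simp
  show "x \<in> cell n (nat \<lfloor>real n * x\<rfloor>)"
    unfolding cell_def using assms(1) unfolding atLeastLessThan_iff *
    by (simp add: field_simps) linarith
  show "nat \<lfloor>real n * x\<rfloor> \<le> n" using 1 by linarith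
qed

context prob_space
begin

text \<open>
  An inequality only, because the cell with index \<open>n\<close> and all later ones stick out of the unit
  interval.
\<close>
lemma prob_all_clocks_in_cell:
  assumes iid: "iid_uniform_clocks M I \<tau>" and J: "finite J" "J \<noteq> {}" "J \<subseteq> I" and "0 < n"
  shows "{\<omega> \<in> space M. \<forall>j\<in>J. \<tau> j \<omega> \<in> cell n m} \<in> events"
    and "prob {\<omega> \<in> space M. \<forall>j\<in>J. \<tau> j \<omega> \<in> cell n m} \<le> (1 / real n) ^ card J"
proof -
  have indep: "indep_vars (\<lambda>_. borel) \<tau> I"
    and dist: "\<And>i. i \<in> I \<Longrightarrow> distr M borel (\<tau> i) = uniform_measure lborel {0..1}"
    using iid unfolding iid_uniform_clocks_def by auto
  have meas: "random_variable borel (\<tau> i)" if "i \<in> I" for i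
    using indep that unfolding indep_vars_def by auto
  have cm: "cell n m \<in> sets borel" unfolding cell_def by simp
  have eq: "{\<omega> \<in> space M. \<forall>j\<in>J. \<tau> j \<omega> \<in> cell n m} = (\<Inter>j\<in>J. \<tau> j -` cell n m \<inter> space M)"
    using J(2) by auto
  show "{\<omega> \<in> space M. \<forall>j\<in>J. \<tau> j \<omega> \<in> cell n m} \<in> events"
    unfolding eq using J cm meas by (intro sets.finite_INT) (auto intro: measurable_sets)
  have one: "prob (\<tau> j -` cell n m \<inter> space M) \<le> 1 / real n" if "j \<in> I" for j
  proof -
    have "prob (\<tau> j -` cell n m \<inter> space M) = measure (uniform_measure lborel {0..1}) (cell n m)"
      using dist[OF that] measure_distr[OF meas[OF that] cm] by simp
    also have "\<dots> = measure lborel ({0..1} \<inter> cell n m)"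
      using cm by (subst measure_uniform_measure) auto
    also have "\<dots> \<le> measure lborel (cell n m)"
      by (rule measure_mono_fmeasurable) (auto simp: cell_def fmeasurable_def divide_right_mono)
    also have "\<dots> = 1 / real n"
      using \<open>0 < n\<close> by (simp add: cell_def divide_simps)
    finally show ?thesis .
  qed
  have "prob (\<Inter>j\<in>J. \<tau> j -` cell n m \<inter> space M) = (\<Prod>j\<in>J. prob (\<tau> j -` cell n m \<inter> space M))"
    using indep_varsD[OF indep J(2,1,3)] cm by simp
  also have "\<dots> \<le> (\<Prod>j\<in>J. 1 / real n)" using J one by (intro prod_mono) auto
  finally show "prob {\<omega> \<in> space M. \<forall>j\<in>J. \<tau> j \<omega> \<in> cell n m} \<le> (1 / real n) ^ card J"
    unfolding eq by simp
qed

lemma AE_not_in_vanishing_events: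
  assumes "\<And>n. B n \<in> events" and "\<And>n. prob (B n) \<le> c n" and "c \<longlonglongrightarrow> 0"
  shows "AE \<omega> in M. \<exists>n. \<omega> \<notin> B n"
proof (rule AE_I)
  show "(\<Inter>n. B n) \<in> events" using assms(1) by auto
  have "prob (\<Inter>n. B n) \<le> c n" for n
    using finite_measure_mono[of "\<Inter>n. B n" "B n"] assms(1,2)[of n] by force
  then have "prob (\<Inter>n. B n) \<le> 0"
    using assms(3) by (intro LIMSEQ_le_const) auto
  then show "emeasure M (\<Inter>n. B n) = 0"
    by (simp add: emeasure_eq_measure measure_le_0_iff)
qed auto

lemma AE_clocks_in_unit_interval:
  assumes iid: "iid_uniform_clocks M I \<tau>" and "countable I"
  shows "AE \<omega> in M. \<forall>i\<in>I. \<tau> i \<omega> \<in> {0..1}"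
  unfolding AE_ball_countable[OF assms(2)]
proof
  fix i assume "i \<in> I"
  then have m: "\<tau> i \<in> borel_measurable M"
    and d: "distr M borel (\<tau> i) = uniform_measure lborel {0..1}"
    using iid unfolding iid_uniform_clocks_def indep_vars_def by auto
  have "AE x in distr M borel (\<tau> i). x \<in> {0..1}"
    unfolding d by (rule AE_uniform_measureI) auto
  then show "AE \<omega> in M. \<tau> i \<omega> \<in> {0..1}" by (rule AE_distrD[OF m])
qed

text \<open>
  Two equal clocks lie in a common cell for every mesh \<open>1 / n\<close>. With \<open>n + 1\<close> cells, each
  containing both clocks with probability at most \<open>1 / n\<^sup>2\<close>, this has probability 0.
\<close>
lemma AE_clocks_distinct:
  assumes iid: "iid_uniform_clocks M I \<tau>" and "countable I"
  shows "AE \<omega> in M. inj_on (\<lambda>i. \<tau> i \<omega>) I"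
proof -
  have "AE \<omega> in M. \<tau> i \<omega> \<noteq> \<tau> j \<omega>" if ij: "i \<in> I" "j \<in> I" "i \<noteq> j" for i j
  proof -
    define B where "B n m = {\<omega> \<in> space M. \<forall>l\<in>{i, j}. \<tau> l \<omega> \<in> cell (Suc n) m}" for n m
    have B: "B n m \<in> events" "prob (B n m) \<le> (1 / real (Suc n)) ^ 2" for n m
      using prob_all_clocks_in_cell[OF iid, of "{i, j}" "Suc n" m] ij
      unfolding B_def by (auto simp: power2_eq_square)
    \<comment> \<open>The mesh is \<open>1 / (n + 1)\<close>, so that the factor \<open>n + 2\<close> counts the cells, the extra one included.\<close>
    have "prob (\<Union>m\<le>Suc n. B n m) \<le> real (n + 2) * (1 / real (Suc n)) ^ 2" for n
    proof -
      have "prob (\<Union>m\<le>Suc n. B n m) \<le> (\<Sum>m\<le>Suc n. prob (B n m))"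
        using B by (intro finite_measure_subadditive_finite) auto
      also have "\<dots> \<le> (\<Sum>m\<le>Suc n. (1 / real (Suc n)) ^ 2)" by (intro sum_mono B)
      finally show ?thesis by simp
    qed
    moreover have "(\<lambda>n. real (n + 2) * (1 / real (Suc n)) ^ 2) \<longlonglongrightarrow> 0"
      by real_asymp
    ultimately have "AE \<omega> in M. \<exists>n. \<omega> \<notin> (\<Union>m\<le>Suc n. B n m)"
      using B by (intro AE_not_in_vanishing_events) auto
    then show ?thesis
      using AE_clocks_in_unit_interval[OF assms] AE_space
    proof eventually_elim
      case (elim \<omega>)
      then obtain n where n: "\<And>m. m \<le> Suc n \<Longrightarrow> \<omega> \<notin> B n m" by auto
      show ?case
      proof
        assume eq: "\<tau> i \<omega> = \<tau> j \<omega>"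
        have "\<tau> i \<omega> \<in> {0..1}" using elim ij by blast
        from cell_index[OF _ this, of "Suc n"] n eq elim(3) show False
          unfolding B_def by fastforce
      qed
    qed
  qed
  then have "AE \<omega> in M. \<forall>i\<in>I. \<forall>j\<in>I. i \<noteq> j \<longrightarrow> \<tau> i \<omega> \<noteq> \<tau> j \<omega>"
    unfolding AE_ball_countable[OF assms(2)] by (auto intro: AE_impI)
  then show ?thesis by eventually_elim (auto simp: inj_on_def)
qed

end

primrec paths :: "('i \<Rightarrow> 'i set) \<Rightarrow> nat \<Rightarrow> 'i \<Rightarrow> 'i list set" where
  "paths nb 0 i = {[i]}"
| "paths nb (Suc k) i = (\<Union>j\<in>nb i. (#) i ` paths nb k j)"

lemma finite_card_paths:
  assumes nb: "\<And>i. i \<in> I \<Longrightarrow> nb i \<subseteq> I \<and> finite (nb i) \<and> card (nb i) \<le> D" and "i \<in> I"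
  shows "finite (paths nb k i) \<and> card (paths nb k i) \<le> D ^ k"
  using \<open>i \<in> I\<close>
proof (induction k arbitrary: i)
  case 0
  then show ?case by simp
next
  case (Suc k)
  have j: "finite (paths nb k j) \<and> card (paths nb k j) \<le> D ^ k" if "j \<in> nb i" for j
    using Suc nb that by blast
  have "card (paths nb (Suc k) i) \<le> (\<Sum>j\<in>nb i. card ((#) i ` paths nb k j))"
    using nb[OF Suc.prems] by (auto intro: card_UN_le)
  also have "\<dots> \<le> (\<Sum>j\<in>nb i. D ^ k)"
    using j by (intro sum_mono) (auto simp: card_image)
  also have "\<dots> \<le> D * D ^ k" using nb[OF Suc.prems] by simp
  finally show ?case using j nb[OF Suc.prems] by auto
qed

lemma paths_length_set:
  assumes "\<And>i. i \<in> I \<Longrightarrow> nb i \<subseteq> I" and "i \<in> I" and "p \<in> paths nb k i"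
  shows "length p = Suc k \<and> set p \<subseteq> I"
  using assms(2,3)
proof (induction k arbitrary: i p)
  case (Suc k)
  then show ?case using assms(1) by fastforce
qed auto

lemma path_of_sequence:
  assumes "\<And>n. f (Suc n) \<in> nb (f n)"
  shows "map f [a..<a + Suc k] \<in> paths nb k (f a)"
proof (induction k arbitrary: a)
  case (Suc k)
  have "map f [a..<a + Suc (Suc k)] = f a # map f [Suc a..<Suc a + Suc k]"
    by (simp add: upt_conv_Cons del: upt_Suc)
  then show ?case using Suc[of "Suc a"] assms[of a] by (auto simp del: upt_Suc)
qed simp

text \<open>
  Union bound over the at most \<open>D ^ k\<close> paths. Cells of length \<open>1 / (D + 1)\<close> make the resulting
  bound \<open>(D / (D + 1)) ^ k\<close> tend to 0. Distinctness of the items is what makes the product formula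
  apply.
\<close>
lemma (in prob_space) AE_no_long_path_in_cell:
  assumes iid: "iid_uniform_clocks M I \<tau>"
    and nb: "\<And>i. i \<in> I \<Longrightarrow> nb i \<subseteq> I \<and> finite (nb i) \<and> card (nb i) \<le> D" and "i \<in> I"
  shows "AE \<omega> in M. \<exists>k. \<forall>p\<in>paths nb k i. distinct p \<longrightarrow> (\<exists>j\<in>set p. \<tau> j \<omega> \<notin> cell (Suc D) m)"
proof -
  define P where "P k = {p \<in> paths nb k i. distinct p}" for k
  define B where "B p = {\<omega> \<in> space M. \<forall>j\<in>set p. \<tau> j \<omega> \<in> cell (Suc D) m}" for p
  have P: "finite (P k)" "card (P k) \<le> D ^ k" for k
  proof -
    have *: "finite (paths nb k i)" "card (paths nb k i) \<le> D ^ k"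
      using finite_card_paths[OF nb \<open>i \<in> I\<close>] by auto
    show "finite (P k)" unfolding P_def using * by simp
    have "card (P k) \<le> card (paths nb k i)"
      unfolding P_def using * by (intro card_mono) auto
    then show "card (P k) \<le> D ^ k" using * by simp
  qed
  have B: "B p \<in> events" "prob (B p) \<le> (1 / real (Suc D)) ^ Suc k" if "p \<in> P k" for p k
  proof -
    have p: "length p = Suc k" "set p \<subseteq> I" "distinct p"
      using paths_length_set[of I nb i p k] nb \<open>i \<in> I\<close> that unfolding P_def by auto
    have "card (set p) = Suc k" using p by (simp add: distinct_card)
    moreover have "set p \<noteq> {}" using p by auto
    ultimately show "B p \<in> events" "prob (B p) \<le> (1 / real (Suc D)) ^ Suc k"
      using prob_all_clocks_in_cell[OF iid, of "set p" "Suc D" m] p unfolding B_def by auto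
  qed
  have "prob (\<Union>p\<in>P k. B p) \<le> (real D / real (Suc D)) ^ k" for k
  proof -
    have "prob (\<Union>p\<in>P k. B p) \<le> (\<Sum>p\<in>P k. prob (B p))"
      using B P by (intro finite_measure_subadditive_finite) auto
    also have "\<dots> \<le> (\<Sum>p\<in>P k. (1 / real (Suc D)) ^ Suc k)" by (intro sum_mono B)
    also have "\<dots> = real (card (P k)) * (1 / real (Suc D)) ^ Suc k" by simp
    also have "\<dots> \<le> real (D ^ k) * (1 / real (Suc D)) ^ k"
      using P(2)[of k] by (intro mult_mono power_decreasing) (auto simp del: of_nat_power)
    finally show ?thesis by (simp add: power_divide)
  qed
  moreover have "(\<lambda>k. (real D / real (Suc D)) ^ k) \<longlonglongrightarrow> 0"
    by (rule LIMSEQ_power_zero) simp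
  ultimately have "AE \<omega> in M. \<exists>k. \<omega> \<notin> (\<Union>p\<in>P k. B p)"
    using B P by (intro AE_not_in_vanishing_events) (auto intro!: sets.finite_UN)
  then show ?thesis using AE_space
    by eventually_elim (auto simp: P_def B_def)
qed

lemma antimono_nat_eventually_constant:
  fixes c :: "nat \<Rightarrow> nat"
  assumes "\<And>n. c (Suc n) \<le> c n"
  obtains a where "\<And>n. a \<le> n \<Longrightarrow> c n = c a"
proof -
  obtain a where a: "\<And>n. c a \<le> c n"
    using ex_has_least_nat[of "\<lambda>_. True" 0 c] by auto
  have "c n = c a" if "a \<le> n" for n
    using a[of n] lift_Suc_antimono_le[of c, OF assms that] by simp
  then show ?thesis using that by blast
qed

text \<open>
  Along an infinite decreasing chain the cell index is a nonincreasing natural number, hence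
  eventually constant; from then on the chain is a path of unlimited length inside one cell.
\<close>
lemma (in prob_space) AE_wf_precedes:
  assumes iid: "iid_uniform_clocks M I \<tau>" and "countable I"
    and nb: "\<And>i. i \<in> I \<Longrightarrow> nb i \<subseteq> I \<and> finite (nb i) \<and> card (nb i) \<le> D"
  shows "AE \<omega> in M. wf (precedes I nb (\<lambda>i. \<tau> i \<omega>))"
proof -
  have "AE \<omega> in M. \<forall>i\<in>I. \<forall>m. \<exists>k. \<forall>p\<in>paths nb k i. distinct p \<longrightarrow>
      (\<exists>j\<in>set p. \<tau> j \<omega> \<notin> cell (Suc D) m)"
    unfolding AE_ball_countable[OF assms(2)] AE_all_countable
    using AE_no_long_path_in_cell[of I \<tau> nb D, OF iid nb] by blast
  then show ?thesis
    using AE_clocks_in_unit_interval[OF iid assms(2)]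
  proof eventually_elim
    case (elim \<omega>)
    show ?case
      unfolding wf_iff_no_infinite_down_chain
    proof
      assume "\<exists>f. \<forall>n. (f (Suc n), f n) \<in> precedes I nb (\<lambda>i. \<tau> i \<omega>)"
      then obtain f where f: "\<And>n. f n \<in> I" "\<And>n. f (Suc n) \<in> nb (f n)"
        "\<And>n. \<tau> (f (Suc n)) \<omega> < \<tau> (f n) \<omega>"
        unfolding precedes_def by blast
      have "inj f"
      proof -
        have "strict_mono (\<lambda>n. - \<tau> (f n) \<omega>)" using f(3) by (simp add: strict_mono_Suc_iff)
        then have "inj (\<lambda>n. - \<tau> (f n) \<omega>)" by (rule strict_mono_imp_inj_on)
        then show ?thesis by (auto simp: inj_on_def)
      qed
      define c where "c n = nat \<lfloor>real (Suc D) * \<tau> (f n) \<omega>\<rfloor>" for n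
      have "c (Suc n) \<le> c n" for n
        unfolding c_def using f(3)[of n]
        by (intro nat_mono floor_mono mult_left_mono) auto
      then obtain a where a: "\<And>n. a \<le> n \<Longrightarrow> c n = c a"
        by (rule antimono_nat_eventually_constant) blast
      have in_cell: "\<tau> (f n) \<omega> \<in> cell (Suc D) (c a)" if "a \<le> n" for n
        using cell_index(1)[of "Suc D" "\<tau> (f n) \<omega>"] elim(2) f(1) a[OF that]
        unfolding c_def by auto
      obtain k where k: "\<forall>p\<in>paths nb k (f a). distinct p \<longrightarrow>
          (\<exists>j\<in>set p. \<tau> j \<omega> \<notin> cell (Suc D) (c a))"
        using elim(1) f(1) by blast
      have "distinct (map f [a..<a + Suc k])"
        using \<open>inj f\<close> by (simp add: distinct_map inj_on_subset[OF _ subset_UNIV] del: upt_Suc)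
      then obtain j where "j \<in> set (map f [a..<a + Suc k])" "\<tau> j \<omega> \<notin> cell (Suc D) (c a)"
        using k path_of_sequence[of f nb a k] f(2) by blast
      then show False using in_cell by auto
    qed
  qed
qed

section \<open>Infinite-volume limits\<close>

lemma overlaps_bound:
  assumes "finite (scope i)" and "card (scope i) \<le> K"
    and "\<And>v. v \<in> scope i \<Longrightarrow> finite {j \<in> I. v \<in> scope j} \<and> card {j \<in> I. v \<in> scope j} \<le> L"
  shows "finite (overlaps I scope i) \<and> card (overlaps I scope i) \<le> K * L"
proof -
  have eq: "overlaps I scope i = (\<Union>v\<in>scope i. {j \<in> I. v \<in> scope j})"
    unfolding overlaps_def by auto
  have "card (overlaps I scope i) \<le> (\<Sum>v\<in>scope i. card {j \<in> I. v \<in> scope j})"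
    unfolding eq using assms(1) by (rule card_UN_le)
  also have "\<dots> \<le> (\<Sum>v\<in>scope i. L)" using assms(3) by (intro sum_mono) auto
  also have "\<dots> \<le> K * L" using assms(2) by simp
  finally show ?thesis unfolding eq using assms(1,3) by auto
qed

text \<open>
  The form common to the three processes: \<open>A U\<close> is the set of items that are active when the
  process runs on \<open>U\<close>. The update may depend on the sample point, to accommodate random attack
  directions; the scopes may not, since the percolation estimate needs a deterministic
  neighbourhood structure.
\<close>
lemma (in prob_space) AE_evolve_has_infinite_volume_limit:
  fixes scope :: "'i \<Rightarrow> 'v set" and step :: "'a \<Rightarrow> 'i \<Rightarrow> ('v \<Rightarrow> nat) \<Rightarrow> ('v \<Rightarrow> nat)"
  assumes iid: "iid_uniform_clocks M I \<tau>" and "countable I"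
    and scope: "\<And>i. i \<in> I \<Longrightarrow> scope i \<subseteq> V \<and> finite (scope i) \<and> card (scope i) \<le> K"
    and site: "\<And>v. v \<in> V \<Longrightarrow> finite {i \<in> I. v \<in> scope i} \<and> card {i \<in> I. v \<in> scope i} \<le> L"
    and loc: "\<And>\<omega> i. \<omega> \<in> space M \<Longrightarrow> i \<in> I \<Longrightarrow> local_update (scope i) (step \<omega> i)"
    and items: "\<And>U. finite U \<Longrightarrow> U \<subseteq> V \<Longrightarrow> finite (A U) \<and> A U \<subseteq> I"
    and exhaust: "\<And>i. i \<in> I \<Longrightarrow> \<exists>S\<subseteq>V. finite S \<and> (\<forall>U. S \<subseteq> U \<longrightarrow> i \<in> A U)"
  shows "AE \<omega> in M. has_infinite_volume_limit V
    (\<lambda>U. evolve (step \<omega>) (\<lambda>i. \<tau> i \<omega>) (A U) s)"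
proof -
  have ov: "overlaps I scope i \<subseteq> I \<and> finite (overlaps I scope i) \<and>
      card (overlaps I scope i) \<le> K * L" if "i \<in> I" for i
  proof -
    have "finite (overlaps I scope i) \<and> card (overlaps I scope i) \<le> K * L"
      by (rule overlaps_bound) (use scope[OF that] site in auto)
    then show ?thesis by (auto simp: overlaps_def)
  qed
  have "AE \<omega> in M. wf (precedes I (overlaps I scope) (\<lambda>i. \<tau> i \<omega>))"
    by (rule AE_wf_precedes[OF iid assms(2) ov])
  then show ?thesis
    using AE_clocks_distinct[OF iid assms(2)] AE_space
  proof eventually_elim
    case (elim \<omega>)
    show ?case
      unfolding has_infinite_volume_limit_def
    proof (intro ballI)
      fix v t assume "v \<in> V"
      obtain l where l: "\<And>B. \<forall>i\<in>I. eventually (\<lambda>n. i \<in> B n) sequentially \<Longrightarrow>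
          eventually (\<lambda>n. finite (B n) \<and> B n \<subseteq> I) sequentially \<Longrightarrow>
          eventually (\<lambda>n. evolve (step \<omega>) (\<lambda>i. \<tau> i \<omega>) (B n) s t v = l) sequentially"
        by (rule evolve_eventually_stable[OF elim(2,1), where step = "step \<omega>" and v = v])
          (use ov site \<open>v \<in> V\<close> loc elim(3) in auto)
      show "\<exists>l. \<forall>W. finite_approximation V W \<longrightarrow>
          (\<lambda>n. evolve (step \<omega>) (\<lambda>i. \<tau> i \<omega>) (A (W n)) s t v) \<longlonglongrightarrow> l"
      proof (intro exI allI impI)
        fix W assume W: "finite_approximation V W"
        have site_ev: "eventually (\<lambda>n. u \<in> W n) sequentially" if "u \<in> V" for u
        proof -
          have "u \<in> (\<Union>n\<in>{1..}. \<Inter>m\<in>{n..}. W m)"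
            using that W unfolding finite_approximation_def by simp
          then obtain n where "\<forall>m\<ge>n. u \<in> W m" by auto
          then show ?thesis unfolding eventually_sequentially by blast
        qed
        have "eventually (\<lambda>n. i \<in> A (W n)) sequentially" if "i \<in> I" for i
        proof -
          obtain S where S: "S \<subseteq> V" "finite S" "\<And>U. S \<subseteq> U \<Longrightarrow> i \<in> A U"
            using exhaust[OF \<open>i \<in> I\<close>] by auto
          have "eventually (\<lambda>n. \<forall>u\<in>S. u \<in> W n) sequentially"
            using S site_ev by (intro eventually_ball_finite) auto
          then show ?thesis by eventually_elim (use S in auto)
        qed
        moreover have "eventually (\<lambda>n. finite (A (W n)) \<and> A (W n) \<subseteq> I) sequentially"
          using eventually_ge_at_top[of "1::nat"]
          by eventually_elim (use W items in \<open>auto simp: finite_approximation_def\<close>)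
        ultimately show "(\<lambda>n. evolve (step \<omega>) (\<lambda>i. \<tau> i \<omega>) (A (W n)) s t v) \<longlonglongrightarrow> l"
          using l[of "\<lambda>n. A (W n)"] by (intro tendsto_eventually) auto
      qed
    qed
  qed
qed

section \<open>The three processes\<close>

text \<open>
  A blocking update writes at one site only but reads all adjacent ones, so its scope is the closed
  neighbourhood. Two such scopes overlap when the sites are at distance at most 2, which is
  still a relation of bounded degree.
\<close>
definition closed_neighbourhood :: "'v set set \<Rightarrow> 'v \<Rightarrow> 'v set" where
  "closed_neighbourhood E v = insert v {u. {u, v} \<in> E}"

lemma card_closed_neighbourhood:
  assumes "finite {e \<in> E. v \<in> e}" and "card {e \<in> E. v \<in> e} \<le> D"
  shows "finite (closed_neighbourhood E v) \<and> card (closed_neighbourhood E v) \<le> Suc D"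
proof -
  have inj: "inj_on (\<lambda>u. {u, v}) {u. {u, v} \<in> E}"
    by (auto simp: inj_on_def doubleton_eq_iff)
  have sub: "(\<lambda>u. {u, v}) ` {u. {u, v} \<in> E} \<subseteq> {e \<in> E. v \<in> e}" by auto
  have "finite {u. {u, v} \<in> E}"
    using finite_subset[OF sub assms(1)] inj by (rule finite_imageD)
  moreover have "card {u. {u, v} \<in> E} \<le> D"
    using card_inj_on_le[OF inj sub assms(1)] assms(2) by simp
  ultimately show ?thesis
    unfolding closed_neighbourhood_def by (simp add: card_insert_if)
qed

lemma local_update_blocking_step: "local_update (closed_neighbourhood E v) (blocking_step E v)"
proof -
  have "(\<forall>u. {u, v} \<in> E \<longrightarrow> x u = 0) \<longleftrightarrow> (\<forall>u. {u, v} \<in> E \<longrightarrow> y u = 0)"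
    if "\<forall>u\<in>closed_neighbourhood E v. x u = y u" for x y :: "'a \<Rightarrow> nat"
    using that unfolding closed_neighbourhood_def by auto
  then show ?thesis
    unfolding local_update_def blocking_step_def by (auto simp: closed_neighbourhood_def)
qed

lemma local_update_dimer_step: "local_update e (dimer_step e)"
  unfolding local_update_def dimer_step_def by auto

lemma local_update_annihilation_step: "a e \<in> e \<Longrightarrow> local_update e (annihilation_step a e)"
  unfolding local_update_def annihilation_step_def by auto

text \<open>
  Sites outside \<open>U\<close> stay vacant and never block, so the update rule may use all edges
  of the infinite graph. This makes the rule independent of \<open>U\<close>, as the comparison of different
  finite vertex sets requires.
\<close>
lemma blocking_rsa_ambient_edges:
  assumes "finite U"
  shows "blocking_rsa U (induced_edges E U) \<tau> t = evolve (blocking_step E) \<tau> U (\<lambda>_. 0) t"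
proof -
  have "fold (blocking_step (induced_edges E U)) xs x = fold (blocking_step E) xs x"
    if "set xs \<subseteq> U" and "\<forall>u. u \<notin> U \<longrightarrow> x u = 0" for xs and x :: "'a \<Rightarrow> nat"
    using that
  proof (induction xs arbitrary: x)
    case (Cons v xs)
    have "(\<forall>u. {u, v} \<in> induced_edges E U \<longrightarrow> x u = 0) \<longleftrightarrow> (\<forall>u. {u, v} \<in> E \<longrightarrow> x u = 0)"
      using Cons.prems unfolding induced_edges_def by auto
    then have "blocking_step (induced_edges E U) v x = blocking_step E v x"
      unfolding blocking_step_def by simp
    moreover have "\<forall>u. u \<notin> U \<longrightarrow> blocking_step E v x u = 0"
      using Cons.prems unfolding blocking_step_def by auto
    ultimately show ?case using Cons by simp
  qed simp
  then show ?thesis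
    unfolding blocking_rsa_def evolve_def using chronological(2)[OF assms, of \<tau>] by auto
qed

lemma has_infinite_volume_limit_cong:
  assumes "has_infinite_volume_limit V Y" and "\<And>U. finite U \<Longrightarrow> U \<subseteq> V \<Longrightarrow> X U = Y U"
  shows "has_infinite_volume_limit V X"
proof -
  have "(\<lambda>n. X (W n) t v) \<longlonglongrightarrow> l"
    if "finite_approximation V W" "(\<lambda>n. Y (W n) t v) \<longlonglongrightarrow> l" for W t v l
  proof -
    have "eventually (\<lambda>n. Y (W n) t v = X (W n) t v) sequentially"
      using eventually_ge_at_top[of "1::nat"]
      by eventually_elim (use that(1) assms(2) in \<open>auto simp: finite_approximation_def\<close>)
    then show ?thesis using that(2) by (rule Lim_transform_eventually[rotated])
  qed
  then show ?thesis using assms(1) unfolding has_infinite_volume_limit_def by metis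
qed

lemma (in prob_space) AE_blocking_limit:
  fixes V :: "'v set"
  assumes graph: "simple_graph V E" and "countable V" and "bounded_degree V E"
    and iid: "iid_uniform_clocks M V \<sigma>"
  shows "AE \<omega> in M. has_infinite_volume_limit V
    (\<lambda>U. blocking_rsa U (induced_edges E U) (\<lambda>v. \<sigma> v \<omega>))"
proof -
  obtain D where D: "\<And>v. v \<in> V \<Longrightarrow> finite {e \<in> E. v \<in> e} \<and> card {e \<in> E. v \<in> e} \<le> D"
    using assms(3) unfolding bounded_degree_def by blast
  have nbhd: "closed_neighbourhood E v \<subseteq> V \<and> finite (closed_neighbourhood E v) \<and>
      card (closed_neighbourhood E v) \<le> Suc D" if "v \<in> V" for v
  proof -
    have "closed_neighbourhood E v \<subseteq> V"
      using graph that unfolding simple_graph_def closed_neighbourhood_def by auto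
    then show ?thesis using card_closed_neighbourhood[of E v D] D[OF that] by simp
  qed
  have "{w \<in> V. v \<in> closed_neighbourhood E w} \<subseteq> closed_neighbourhood E v" for v
    unfolding closed_neighbourhood_def by (auto simp: insert_commute)
  then have site: "finite {w \<in> V. v \<in> closed_neighbourhood E w} \<and>
      card {w \<in> V. v \<in> closed_neighbourhood E w} \<le> Suc D" if "v \<in> V" for v
    using nbhd[OF that] by (meson card_mono finite_subset order_trans)
  have "AE \<omega> in M. has_infinite_volume_limit V
      (\<lambda>U. evolve (blocking_step E) (\<lambda>v. \<sigma> v \<omega>) U (\<lambda>_. 0))"
    by (rule AE_evolve_has_infinite_volume_limit[where scope = "closed_neighbourhood E"
            and step = "\<lambda>_. blocking_step E" and K = "Suc D" and L = "Suc D",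
          OF iid \<open>countable V\<close> nbhd site local_update_blocking_step])
      (auto intro!: exI[where x = "{_}"])
  then show ?thesis
    by eventually_elim
      (erule has_infinite_volume_limit_cong, simp add: blocking_rsa_ambient_edges fun_eq_iff)
qed

lemma countable_edges:
  assumes "simple_graph V E" and "countable V"
  shows "countable E"
proof (rule countable_subset)
  show "E \<subseteq> {A. A \<subseteq> V \<and> finite A}"
    using assms(1) unfolding simple_graph_def by (auto intro: card_ge_0_finite)
  show "countable {A. A \<subseteq> V \<and> finite A}"
    using countable_Collect_finite_subset[OF assms(2)] by (simp add: conj_commute)
qed

lemma (in prob_space) AE_edge_process_limit:
  fixes V :: "'v set" and step :: "'a \<Rightarrow> 'v set \<Rightarrow> ('v \<Rightarrow> nat) \<Rightarrow> ('v \<Rightarrow> nat)"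
  assumes graph: "simple_graph V E" and "countable V" and "bounded_degree V E"
    and iid: "iid_uniform_clocks M E \<tau>"
    and loc: "\<And>\<omega> e. \<omega> \<in> space M \<Longrightarrow> e \<in> E \<Longrightarrow> local_update e (step \<omega> e)"
  shows "AE \<omega> in M. has_infinite_volume_limit V
    (\<lambda>U. evolve (step \<omega>) (\<lambda>e. \<tau> e \<omega>) (induced_edges E U) s)"
proof -
  obtain D where D: "\<And>v. v \<in> V \<Longrightarrow> finite {e \<in> E. v \<in> e} \<and> card {e \<in> E. v \<in> e} \<le> D"
    using assms(3) unfolding bounded_degree_def by blast
  have edge: "e \<subseteq> V \<and> finite e \<and> card e \<le> 2" if "e \<in> E" for e
    using graph that unfolding simple_graph_def by (auto intro: card_ge_0_finite)
  have items: "finite (induced_edges E U) \<and> induced_edges E U \<subseteq> E" if "finite U" for U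
    unfolding induced_edges_def using that by (auto intro: finite_subset[of _ "Pow U"])
  show ?thesis
    by (rule AE_evolve_has_infinite_volume_limit[where scope = "\<lambda>e. e" and step = step
            and K = 2 and L = D,
          OF iid countable_edges[OF graph \<open>countable V\<close>] edge D loc])
      (use edge items in \<open>auto simp: induced_edges_def\<close>)
qed

text \<open>
  The annihilation update is local because the attacked site is an endpoint of its edge. This holds
  at every sample point, the direction being a random variable with values in the edge.
\<close>
theorem proposition1:
  fixes V :: "'v set" and E :: "'v set set" and M :: "'w measure"
    and \<sigma> :: "'v \<Rightarrow> 'w \<Rightarrow> real"
    and \<tau> :: "'v set \<Rightarrow> 'w \<Rightarrow> real"
    and \<alpha> :: "'v set \<Rightarrow> 'w \<Rightarrow> 'v"
  assumes "simple_graph V E" and "countable V" and "infinite V" and "bounded_degree V E"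
    and "prob_space M"
  shows
    "(iid_uniform_clocks M V \<sigma> \<longrightarrow>
        (AE \<omega> in M. has_infinite_volume_limit V
           (\<lambda>U. blocking_rsa U (induced_edges E U) (\<lambda>v. \<sigma> v \<omega>))))
     \<and>
     (iid_uniform_clocks M E \<tau> \<longrightarrow>
        (AE \<omega> in M. has_infinite_volume_limit V
           (\<lambda>U. dimer_rsa (induced_edges E U) (\<lambda>e. \<tau> e \<omega>))))
     \<and>
     (iid_uniform_clocks M E \<tau> \<and> fair_attack_directions M E \<tau> \<alpha> \<longrightarrow>
        (AE \<omega> in M. has_infinite_volume_limit V
           (\<lambda>U. annihilation (induced_edges E U) (\<lambda>e. \<tau> e \<omega>) (\<lambda>e. \<alpha> e \<omega>))))"
proof (intro conjI impI)
  interpret prob_space M by fact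
  note graph = \<open>simple_graph V E\<close> \<open>countable V\<close> \<open>bounded_degree V E\<close>
  show "AE \<omega> in M. has_infinite_volume_limit V
      (\<lambda>U. blocking_rsa U (induced_edges E U) (\<lambda>v. \<sigma> v \<omega>))"
    if "iid_uniform_clocks M V \<sigma>"
    using AE_blocking_limit[OF graph that] .
  show "AE \<omega> in M. has_infinite_volume_limit V
      (\<lambda>U. dimer_rsa (induced_edges E U) (\<lambda>e. \<tau> e \<omega>))"
    if "iid_uniform_clocks M E \<tau>"
    unfolding dimer_rsa_def
    by (rule AE_edge_process_limit[OF graph that local_update_dimer_step])
  show "AE \<omega> in M. has_infinite_volume_limit V
      (\<lambda>U. annihilation (induced_edges E U) (\<lambda>e. \<tau> e \<omega>) (\<lambda>e. \<alpha> e \<omega>))"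
    if directions: "iid_uniform_clocks M E \<tau> \<and> fair_attack_directions M E \<tau> \<alpha>"
  proof -
    have "\<alpha> e \<omega> \<in> e" if "\<omega> \<in> space M" "e \<in> E" for \<omega> e
    proof -
      have "\<alpha> e \<in> measurable M (count_space e)"
        using directions \<open>e \<in> E\<close>
        unfolding fair_attack_directions_def indep_vars_def by auto
      then show ?thesis using measurable_space[of "\<alpha> e" M "count_space e" \<omega>] that(1) by simp
    qed
    then have "local_update e (annihilation_step (\<lambda>e. \<alpha> e \<omega>) e)"
      if "\<omega> \<in> space M" "e \<in> E" for \<omega> e
      using that by (intro local_update_annihilation_step) blast
    then show ?thesis
      unfolding annihilation_def
      by (rule AE_edge_process_limit[OF graph conjunct1[OF directions]])
  qed
qed

end
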